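(* Let $1\le p<n$ be integers. The map $\varphi_{\mathrm{ss}}$ is an isomorphism between the posets $(\tilde{\mathcal I}_{\mathrm{ss}},\prec_{\mathrm{ss}})$ and $(\mathcal J(\tilde Q),\subset)$.
   Context: Notation: $\mathbb N_0=\{0,1,2,\dots\}$, and $[a,b]$ denotes the set of integers $x$ with $a\le x\le b$. Fix integers $1\le p<n$. $\tilde{\mathcal I}_{\mathrm{ss}}$ is the set of all symbols $I^{(k)}$ with $I$ a (strictly) increasing $p$-tuple of integers in $[1,n]$ and $k\in\mathbb N_0$. For $I=(\alpha_1,\dots,\alpha_p)$ and $I'=(\alpha'_1,\dots,\alpha'_p)$ one sets $I^{(k)}\preceq_{\mathrm{ss}}I'^{(k')}$ iff $k\le k'$ and $\alpha_i\le\alpha'_{i'}$ for all $i,i'\in[1,p]$ with $i'-i=k'-k$; $\prec_{\mathrm{ss}}$ is the strict relation. The poset $(\tilde Q,\prec)$ consists of elements $q_{i,j}$ with integers $i\ge1$, $j\ge p+1$, $j-i\in[0,n-1]$, where $q_{i_1,j_1}\preceq q_{i_2,j_2}$ iff at least one of: (i) $i_1\le i_2$ and $j_1\le j_2$; (ii) $i_1+p\le i_2$; (iii) $j_1+n-p\le j_2$. $\mathcal J(\tilde Q)$ is the set of finite order ideals (finite down-closed subsets), ordered by inclusion. For $I^{(k)}\in\tilde{\mathcal I}_{\mathrm{ss}}$ with $I=(\alpha_1,\dots,\alpha_p)$, $\varphi_{\mathrm{ss}}(I^{(k)})\in\mathcal J(\tilde Q)$ is the subset containing all $q_{i,j}\in\tilde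 Q$ with $i\le k$, and, for every $i\in[k+1,k+p]$, those $q_{i,j}\in\tilde Q$ for which $j\le i+\alpha_{p+1-(i-k)}-1$ (and no other elements). *)

theory Defs
  imports Main
begin

definition poset_isomorphism ::
    "'a set \<Rightarrow> 'a rel \<Rightarrow> 'b set \<Rightarrow> 'b rel \<Rightarrow> ('a \<Rightarrow> 'b) \<Rightarrow> bool"
  where "poset_isomorphism A r B s f \<longleftrightarrow>
    partial_order_on A r \<and> partial_order_on B s \<and> bij_betw f A B \<and>
    (\<forall>x\<in>A. \<forall>y\<in>A. (x, y) \<in> r \<longleftrightarrow> (f x, f y) \<in> s)"

definition finite_order_ideals :: "'a set \<Rightarrow> 'a rel \<Rightarrow> 'a set set"
  where "finite_order_ideals A r =
    {D. D \<subseteq> A \<and> finite D \<and> (\<forall>x\<in>D. \<forall>y\<in>A. (y, x) \<in> r \<longrightarrow> y \<in> D)}"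

text \<open>The symbol \<open>I\<^sup>(\<^sup>k\<^sup>)\<close> is the pair \<open>(I, k)\<close>, where the tuple \<open>I\<close> is a list of length \<open>p\<close>.
  Lists are indexed from 0, so the component \<open>\<alpha>\<^sub>i\<close> is \<open>I ! (i - 1)\<close>.\<close>

definition component :: "nat list \<Rightarrow> nat \<Rightarrow> nat"
  where "component I i = I ! (i - 1)"

definition I_ss :: "nat \<Rightarrow> nat \<Rightarrow> (nat list \<times> nat) set"
  where "I_ss p n =
    {(I, k). length I = p \<and> sorted_wrt (<) I \<and> set I \<subseteq> {1..n}}"

text \<open>The condition \<open>i' - i = k' - k\<close> on integers is stated as \<open>i' + k = i + k'\<close> to avoid
  truncated subtraction.\<close>

definition le_ss :: "nat \<Rightarrow> nat list \<times> nat \<Rightarrow> nat list \<times> nat \<Rightarrow> bool"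
  where "le_ss p = (\<lambda>(I, k) (I', k').
    k \<le> k' \<and>
    (\<forall>i\<in>{1..p}. \<forall>i'\<in>{1..p}. i' + k = i + k' \<longrightarrow> component I i \<le> component I' i'))"

text \<open>The element \<open>q\<^sub>i\<^sub>,\<^sub>j\<close> is the pair \<open>(i, j)\<close>.\<close>

definition Q :: "nat \<Rightarrow> nat \<Rightarrow> (nat \<times> nat) set"
  where "Q p n = {(i, j). 1 \<le> i \<and> p + 1 \<le> j \<and> i \<le> j \<and> j - i \<le> n - 1}"

definition le_Q :: "nat \<Rightarrow> nat \<Rightarrow> nat \<times> nat \<Rightarrow> nat \<times> nat \<Rightarrow> bool"
  where "le_Q p n = (\<lambda>(i\<^sub>1, j\<^sub>1) (i\<^sub>2, j\<^sub>2).
    (i\<^sub>1 \<le> i\<^sub>2 \<and> j\<^sub>1 \<le> j\<^sub>2) \<or> i\<^sub>1 + p \<le> i\<^sub>2 \<or> j\<^sub>1 + (n - p) \<le> j\<^sub>2)"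

lemma partial_order_on_Q:
  assumes "1 \<le> p" and "p < n"
  shows "partial_order_on (Q p n) (relation_of (le_Q p n) (Q p n))"
proof (rule partial_order_on_relation_ofI)
  show "le_Q p n a a" if "a \<in> Q p n" for a
    using that by (auto simp: le_Q_def)
next
  fix a b c
  assume *: "a \<in> Q p n" "b \<in> Q p n" "c \<in> Q p n" "le_Q p n a b" "le_Q p n b c"
  obtain i j i' j' i'' j'' where eqs: "a = (i, j)" "b = (i', j')" "c = (i'', j'')"
    by (metis surj_pair)
  obtain d where n: "n = p + d"
    using assms less_imp_add_positive by blast
  have "i \<le> j" "j < i + n" "i' \<le> j'" "j' < i' + n" "i'' \<le> j''" "j'' < i'' + n"
    using * assms by (auto simp: eqs Q_def)
  moreover have "i \<le> i' \<and> j \<le> j' \<or> i + p \<le> i' \<or> j + d \<le> j'"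
    and "i' \<le> i'' \<and> j' \<le> j'' \<or> i' + p \<le> i'' \<or> j' + d \<le> j''"
    using * by (auto simp: eqs le_Q_def n)
  ultimately have "i \<le> i'' \<and> j \<le> j'' \<or> i + p \<le> i'' \<or> j + d \<le> j''"
    unfolding n by linarith
  then show "le_Q p n a c"
    by (simp add: eqs le_Q_def n)
next
  fix a b
  assume *: "a \<in> Q p n" "b \<in> Q p n" "le_Q p n a b" "le_Q p n b a"
  then show "a = b"
    using assms unfolding Q_def le_Q_def by clarsimp linarith
qed

definition J_Q :: "nat \<Rightarrow> nat \<Rightarrow> (nat \<times> nat) set set"
  where "J_Q p n = finite_order_ideals (Q p n) (relation_of (le_Q p n) (Q p n))"

text \<open>For \<open>i \<in> {k + 1..k + p}\<close> the index \<open>p + 1 - (i - k)\<close> lies in \<open>{1..p}\<close>, and no subtraction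
  below is truncated.\<close>

definition phi_ss :: "nat \<Rightarrow> nat \<Rightarrow> nat list \<times> nat \<Rightarrow> (nat \<times> nat) set"
  where "phi_ss p n = (\<lambda>(I, k).
    {(i, j) \<in> Q p n. i \<le> k \<or>
      i \<in> {k + 1..k + p} \<and> j \<le> i + component I (p + 1 - (i - k)) - 1})"

end

theory Submission
  imports Defs
begin

text \<open>Row \<open>i\<close> of \<open>Q\<close> consists of the \<open>(i, j)\<close> with fixed \<open>i\<close>. In a finite order ideal every row is an
  initial segment; let \<open>b i\<close> be the first column missing from row \<open>i\<close>. If \<open>k\<close> is least such that all
  rows beyond \<open>k + p\<close> are empty, then condition (ii) makes the rows up to \<open>k\<close> full, condition (i)
  gives \<open>k + p < b i\<close>, and (i) and (iii) together make \<open>b\<close> weakly decreasing on \<open>{k + 1..k + p}\<close>. Hence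
  \<open>b i - i\<close>, read from \<open>i = k + p\<close> down to \<open>i = k + 1\<close>, is a strictly increasing tuple in \<open>[1, n]\<close>,
  and it is the preimage of the ideal.\<close>

lemma Q_iff: "(i, j) \<in> Q p n \<longleftrightarrow> 1 \<le> i \<and> p < j \<and> i \<le> j \<and> j < i + n" if "p < n"
  using that by (auto simp: Q_def)

text \<open>Form suited to linear arithmetic: for \<open>k < i\<close> the nested difference
  flattens, and the strict bound absorbs the \<open>- 1\<close> because \<open>1 \<le> i\<close> in
  \<open>Q\<close>.\<close>

lemma phi_ss_iff:
  "(i, j) \<in> phi_ss p n (I, k) \<longleftrightarrow>
    (i, j) \<in> Q p n \<and> (i \<le> k \<or> k < i \<and> i \<le> k + p \<and> j < i + component I (p + 1 + k - i))"
proof -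
  have "p + 1 - (i - k) = p + 1 + k - i" if "k < i"
    using that by auto
  then show ?thesis
    by (auto simp: phi_ss_def Q_def)
qed

lemma component_diff:
  assumes "(I, k) \<in> I_ss p n" "1 \<le> i" "i \<le> i'" "i' \<le> p"
  shows "component I i + (i' - i) \<le> component I i'"
  using \<open>i \<le> i'\<close> \<open>i' \<le> p\<close>
proof (induction i' rule: dec_induct)
  case (step m)
  then have "I ! (m - 1) < I ! m"
    using assms by (auto simp: I_ss_def sorted_wrt_iff_nth_less)
  with step show ?case
    by (auto simp: component_def)
qed simp

text \<open>Consecutive entries differ by at least 1, so \<open>component_diff\<close> propagates
  the bounds 1 and \<open>n\<close> from the two end entries.\<close>

lemma component_bounds:
  assumes "(I, k) \<in> I_ss p n" "1 \<le> i" "i \<le> p"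
  shows "i \<le> component I i" "component I i + (p - i) \<le> n"
proof -
  have "component I m \<in> {1..n}" if "1 \<le> m" "m \<le> p" for m
    using assms that nth_mem[of "m - 1" I] unfolding I_ss_def component_def by fastforce
  then have "1 \<le> component I 1" "component I p \<le> n"
    using assms by auto
  then show "i \<le> component I i" "component I i + (p - i) \<le> n"
    using component_diff[OF assms(1), of 1 i] component_diff[OF assms(1), of i p] assms by auto
qed

lemma phi_ss_in_J_Q:
  assumes "1 \<le> p" "p < n" "x \<in> I_ss p n"
  shows "phi_ss p n x \<in> J_Q p n"
proof -
  obtain I k where x: "x = (I, k)"
    by fastforce
  note I = assms(3)[unfolded x]
  have "finite (phi_ss p n x)"
  proof (rule finite_subset)
    show "phi_ss p n x \<subseteq> {..k + p} \<times> {..k + p + n}"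
      using \<open>p < n\<close> by (auto simp: x phi_ss_iff Q_iff)
  qed simp
  moreover have "phi_ss p n x \<subseteq> Q p n"
    by (auto simp: x phi_ss_iff)
  moreover have "(i, j) \<in> phi_ss p n x"
    if D: "(i', j') \<in> phi_ss p n x" and q: "(i, j) \<in> Q p n" and le: "le_Q p n (i, j) (i', j')"
    for i j i' j'
  proof (cases "i \<le> k")
    case True
    with q show ?thesis
      by (simp add: x phi_ss_iff)
  next
    case False
    have Q': "(i', j') \<in> Q p n"
      and row: "i' \<le> k \<or> k < i' \<and> i' \<le> k + p \<and> j' < i' + component I (p + 1 + k - i')"
      using D by (auto simp: x phi_ss_iff)
    \<comment> \<open>No element lies beyond column \<open>k + n\<close>. In row
      \<open>i' > k\<close> the entry has index \<open>l = p + 1 + k - i'\<close>, and it is at most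
      \<open>n - (p - l)\<close>.\<close>
    have upper: "j' \<le> k + n"
    proof (cases "i' \<le> k")
      case True
      with Q' \<open>p < n\<close> show ?thesis
        by (simp add: Q_iff)
    next
      case False
      with row have "1 \<le> p + 1 + k - i'" "p + 1 + k - i' \<le> p"
        by auto
      from component_bounds(2)[OF I this] row False show ?thesis
        by linarith
    qed
    have "\<not> i + p \<le> i'"
      using row False by auto
    then consider "i \<le> i'" "j \<le> j'" | "j + (n - p) \<le> j'"
      using le by (auto simp: le_Q_def)
    then have "i \<le> k + p \<and> j < i + component I (p + 1 + k - i)"
    proof cases
      case 1
      with row False have i': "k < i'" "i' \<le> k + p" "j' < i' + component I (p + 1 + k - i')"
        by auto
      have "component I (p + 1 + k - i') + (i' - i) \<le> component I (p + 1 + k - i)"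
        using component_diff[OF I, of "p + 1 + k - i'" "p + 1 + k - i"] 1 False i' by auto
      with 1 i' show ?thesis
        by linarith
    next
      case 2
      \<comment> \<open>Condition (iii) lands in columns up to \<open>k + p\<close>. Each row in
        \<open>{k + 1..k + p}\<close> contains all of its elements there, since the entry with index
        \<open>l\<close> is at least \<open>l\<close>.\<close>
      with upper have "j \<le> k + p"
        using \<open>p < n\<close> by linarith
      moreover from this q \<open>p < n\<close> have "i \<le> k + p"
        by (simp add: Q_iff)
      ultimately show ?thesis
        using component_bounds(1)[OF I, of "p + 1 + k - i"] False by linarith
    qed
    with q False show ?thesis
      by (simp add: x phi_ss_iff)
  qed
  ultimately show ?thesis
    by (fastforce simp: J_Q_def finite_order_ideals_def relation_of_def)
qed

text \<open>The entry with index \<open>l\<close> governs row \<open>k + p + 1 - l\<close>, so the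
  index condition in \<open>le_ss\<close> pairs the entries that govern the same row, and inclusion
  can be tested row by row.\<close>

lemma le_ss_iff_phi_ss_subset:
  assumes "1 \<le> p" "p < n" "x \<in> I_ss p n" "y \<in> I_ss p n"
  shows "le_ss p x y \<longleftrightarrow> phi_ss p n x \<subseteq> phi_ss p n y"
proof -
  obtain I k I' k' where xy: "x = (I, k)" "y = (I', k')"
    by fastforce
  note I = assms(3)[unfolded xy] and I' = assms(4)[unfolded xy]
  show ?thesis
  proof
    assume "le_ss p x y"
    then have "k \<le> k'" and
      le: "\<And>l l'. l \<in> {1..p} \<Longrightarrow> l' \<in> {1..p} \<Longrightarrow> l' + k = l + k' \<Longrightarrow> component I l \<le> component I' l'"
      by (auto simp: xy le_ss_def)
    have "(i, j) \<in> phi_ss p n y" if "(i, j) \<in> phi_ss p n x" for i j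
    proof (cases "i \<le> k'")
      case True
      with that show ?thesis
        by (simp add: xy phi_ss_iff)
    next
      case False
      with that \<open>k \<le> k'\<close> have "component I (p + 1 + k - i) \<le> component I' (p + 1 + k' - i)"
        by (intro le) (auto simp: xy phi_ss_iff)
      with that False \<open>k \<le> k'\<close> show ?thesis
        by (auto simp: xy phi_ss_iff)
    qed
    then show "phi_ss p n x \<subseteq> phi_ss p n y"
      by auto
  next
    assume sub: "phi_ss p n x \<subseteq> phi_ss p n y"
    have "k \<le> k'"
    proof (cases "k = 0")
      case False
      \<comment> \<open>The diagonal element of the last possible row, present since the first entry
        is positive. It needs \<open>k \<noteq> 0\<close> to lie beyond column
        \<open>p\<close>.\<close>
      then have "(k + p, k + p) \<in> phi_ss p n x"
        using component_bounds[OF I, of 1] assms(1,2) by (auto simp: xy phi_ss_iff Q_iff)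
      with sub have "(k + p, k + p) \<in> phi_ss p n y"
        by blast
      then show ?thesis
        by (auto simp: xy phi_ss_iff)
    qed simp
    moreover have "component I l \<le> component I' l'"
      if l: "1 \<le> l" "l \<le> p" "1 \<le> l'" "l' \<le> p" and eq: "l' + k = l + k'" for l l'
    proof (cases "p < k + p - l + component I l")
      case True
      \<comment> \<open>The rightmost element of the row governed by \<open>l\<close>.\<close>
      define i j where "i = k + p + 1 - l" and "j = k + p - l + component I l"
      have i: "p + 1 + k - i = l" "p + 1 + k' - i = l'" "k < i" "k' < i" "i \<le> k + p"
        using l eq by (auto simp: i_def)
      have j: "j + 1 = i + component I l"
        using l by (auto simp: i_def j_def)
      have "(i, j) \<in> phi_ss p n x"
        using True i j l component_bounds[OF I l(1,2)] assms(2)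
        by (auto simp: xy phi_ss_iff Q_iff j_def[symmetric])
      with sub have "(i, j) \<in> phi_ss p n y"
        by blast
      with i j show ?thesis
        by (auto simp: xy phi_ss_iff)
    next
      case False
      \<comment> \<open>The row governed by \<open>l\<close> is empty, which forces
        \<open>k = 0\<close> and entry \<open>l\<close>; the other entry is at least
        \<open>l' \<ge> l\<close>.\<close>
      then show ?thesis
        using component_bounds(1)[OF I l(1,2)] component_bounds(1)[OF I' l(3,4)] l eq \<open>k \<le> k'\<close>
        by linarith
    qed
    ultimately show "le_ss p x y"
      by (auto simp: xy le_ss_def)
  qed
qed

text \<open>Once \<open>k = k'\<close>, only equal indices are compared. A direct argument is used
  because injectivity of \<open>phi_ss\<close> is later deduced from this.\<close>

lemma le_ss_antisym:
  assumes "x \<in> I_ss p n" "y \<in> I_ss p n" "le_ss p x y" "le_ss p y x"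
  shows "x = y"
proof -
  obtain I k I' k' where xy: "x = (I, k)" "y = (I', k')"
    by fastforce
  have k: "k = k'"
    using assms by (auto simp: xy le_ss_def)
  have "component I i = component I' i" if "1 \<le> i" "i \<le> p" for i
    using assms that k by (auto simp: xy le_ss_def intro: antisym)
  from this[of "Suc m" for m] have "I = I'"
    using assms by (auto simp: xy I_ss_def component_def intro!: nth_equalityI)
  with k show ?thesis
    by (simp add: xy)
qed

lemma partial_order_on_I_ss:
  assumes "1 \<le> p" "p < n"
  shows "partial_order_on (I_ss p n) (relation_of (le_ss p) (I_ss p n))"
proof (rule partial_order_on_relation_ofI)
  note iff = le_ss_iff_phi_ss_subset[OF assms]
  show "le_ss p x x" if "x \<in> I_ss p n" for x
    using that by (simp add: iff)
  show "le_ss p x z"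
    if "x \<in> I_ss p n" "y \<in> I_ss p n" "z \<in> I_ss p n" "le_ss p x y" "le_ss p y z" for x y z
    using that by (auto simp: iff)
qed (rule le_ss_antisym)

section \<open>Recovering a symbol from a finite order ideal\<close>

lemma phi_ss_surj:
  assumes "1 \<le> p" "p < n" "D \<in> J_Q p n"
  shows "\<exists>x\<in>I_ss p n. phi_ss p n x = D"
proof -
  have DQ: "D \<subseteq> Q p n" and fin: "finite D"
    using assms by (auto simp: J_Q_def finite_order_ideals_def)
  have ideal: "(i, j) \<in> D"
      if "(i', j') \<in> D" "1 \<le> i" "p < j" "i \<le> j" "j < i + n"
        "(i \<le> i' \<and> j \<le> j') \<or> i + p \<le> i' \<or> j + (n - p) \<le> j'" for i j i' j'
  proof -
    have "(i, j) \<in> Q p n" "(i', j') \<in> Q p n"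
      using that DQ \<open>p < n\<close> by (auto simp: Q_iff)
    moreover have "le_Q p n (i, j) (i', j')"
      using that by (simp add: le_Q_def)
    ultimately have "((i, j), (i', j')) \<in> relation_of (le_Q p n) (Q p n)"
      by (simp add: relation_of_def)
    with assms(3) that(1) \<open>(i, j) \<in> Q p n\<close> show ?thesis
      unfolding J_Q_def finite_order_ideals_def by blast
  qed
  have D_bounds: "1 \<le> i" "p < j" "i \<le> j" "j < i + n" if "(i, j) \<in> D" for i j
    using subsetD[OF DQ that] \<open>p < n\<close> by (auto simp: Q_iff)
  define k where "k = (LEAST k. \<forall>(i, j)\<in>D. i \<le> k + p)"
  \<comment> \<open>Some bound exists, so the least one does; for empty \<open>D\<close> the claim
    is vacuous whatever \<open>Max\<close> returns.\<close>
  have "\<forall>(i, j)\<in>D. i \<le> Max (fst ` D) + p"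
    using fin by (auto intro!: trans_le_add1 Max_ge rev_image_eqI)
  then have "\<forall>(i, j)\<in>D. i \<le> k + p"
    unfolding k_def by (rule LeastI)
  then have row_le: "i \<le> k + p" if "(i, j) \<in> D" for i j
    using that by auto
  have last_row: "\<exists>j. (k + p, j) \<in> D" if "k \<noteq> 0"
  proof -
    have "\<not> (\<forall>(i, j)\<in>D. i \<le> (k - 1) + p)"
      using not_less_Least[of "k - 1" "\<lambda>k. \<forall>(i, j)\<in>D. i \<le> k + p"] that by (simp add: k_def)
    then obtain i j where "(i, j) \<in> D" "k - 1 + p < i"
      by auto
    with row_le[of i j] that have "i = k + p"
      by linarith
    with \<open>(i, j) \<in> D\<close> show ?thesis
      by blast
  qed
  have full: "(i, j) \<in> D" if "(i, j) \<in> Q p n" "i \<le> k" for i j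
  proof -
    have "k \<noteq> 0"
      using that \<open>p < n\<close> by (auto simp: Q_iff)
    then obtain j' where "(k + p, j') \<in> D"
      using last_row by blast
    with that \<open>p < n\<close> show ?thesis
      by (auto simp: Q_iff intro: ideal)
  qed
  define b where "b i = (LEAST j. p < j \<and> i \<le> j \<and> (i, j) \<notin> D)" for i
  \<comment> \<open>Column \<open>i + n\<close> lies outside \<open>Q\<close>, so a missing column
    always exists; a full row has \<open>b i = i + n\<close>.\<close>
  have "p < i + n \<and> i \<le> i + n \<and> (i, i + n) \<notin> D" for i
    using D_bounds(4) \<open>p < n\<close> by fastforce
  then have b: "p < b i \<and> i \<le> b i \<and> (i, b i) \<notin> D" and b_le: "b i \<le> i + n" for i
    unfolding b_def by (rule LeastI, rule Least_le)
  have b_min: "b i \<le> j" if "p < j" "i \<le> j" "(i, j) \<notin> D" for i j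
    unfolding b_def by (rule Least_le) (use that in blast)
  have D_iff: "(i, j) \<in> D \<longleftrightarrow> (i, j) \<in> Q p n \<and> j < b i" for i j
  proof (cases "(i, j) \<in> D")
    case True
    then have "\<not> b i \<le> j"
      using b[of i] D_bounds[OF True] ideal[OF True, of i "b i"] by auto
    with True DQ show ?thesis
      by auto
  next
    case False
    then show ?thesis
      using b_min[of j i] \<open>p < n\<close> by (auto simp: Q_iff)
  qed
  have b_gt: "k + p < b i" if "k < i" "i \<le> k + p" for i
  proof (cases "k = 0")
    case False
    then obtain j where j: "(k + p, j) \<in> D"
      using last_row by blast
    \<comment> \<open>Condition (i) applies because \<open>j \<ge> k + p\<close> for an element of
      row \<open>k + p\<close>.\<close>
    have "(i, k + p) \<in> D"
      by (rule ideal[OF j]) (use that False D_bounds[OF j] \<open>p < n\<close> in auto)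
    then show ?thesis
      by (simp add: D_iff)
  qed (use b in auto)
  have b_antimono: "b i' \<le> b i" if "k < i" "i < i'" "i' \<le> k + p" for i i'
  proof (rule b_min)
    show "p < b i"
      using b by auto
    show i'b: "i' \<le> b i"
      using b_gt[of i] that by auto
    show "(i', b i) \<notin> D"
    proof
      assume D: "(i', b i) \<in> D"
      show False
      proof (cases "b i < i + n")
        case True
        then have "(i, b i) \<in> D"
          using that b[of i] by (intro ideal[OF D]) auto
        with b show False
          by auto
      next
        case False
        \<comment> \<open>Here \<open>b i = i + n = (i + p) + (n - p)\<close>, so (iii) yields an
          element in row \<open>i + p\<close>, which is beyond \<open>k + p\<close>.\<close>
        then have "(i + p, i + p) \<in> D"
          using that assms(1,2) b_le[of i] by (intro ideal[OF D]) auto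
        then show False
          using row_le[of "i + p" "i + p"] that by auto
      qed
    qed
  qed
  define a where "a l = b (k + p + 1 - l) - (k + p + 1 - l)" for l
  define I where "I = map a [1..<p + 1]"
  have comp: "component I l = a l" if "1 \<le> l" "l \<le> p" for l
    using that by (simp add: I_def component_def del: upt_Suc)
  have a_add: "a l + (k + p + 1 - l) = b (k + p + 1 - l)" for l
    using b[of "k + p + 1 - l"] by (simp add: a_def)
  have a_less: "a l < a l'" if "1 \<le> l" "l < l'" "l' \<le> p" for l l'
  proof -
    have "b (k + p + 1 - l) \<le> b (k + p + 1 - l')"
      by (rule b_antimono) (use that in auto)
    with that a_add[of l] a_add[of l'] show ?thesis
      by linarith
  qed
  \<comment> \<open>The lower bound comes from \<open>b_gt\<close>, as the row number is at most
    \<open>k + p\<close>; the upper bound is \<open>b_le\<close>.\<close>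
  have a_range: "1 \<le> a l \<and> a l \<le> n" if "1 \<le> l" "l \<le> p" for l
    using that a_add[of l] b_gt[of "k + p + 1 - l"] b_le[of "k + p + 1 - l"] by linarith
  have "(I, k) \<in> I_ss p n"
    using a_less a_range by (fastforce simp: I_ss_def I_def sorted_wrt_iff_nth_less simp del: upt_Suc)
  moreover have "(i, j) \<in> phi_ss p n (I, k) \<longleftrightarrow> (i, j) \<in> D" for i j
  proof (cases "k < i \<and> i \<le> k + p")
    case True
    then have "i + component I (p + 1 + k - i) = b i"
      using comp[of "p + 1 + k - i"] a_add[of "p + 1 + k - i"] by auto
    with True show ?thesis
      by (auto simp: phi_ss_iff D_iff)
  next
    case False
    then show ?thesis
      using full row_le DQ by (auto simp: phi_ss_iff)
  qed
  then have "phi_ss p n (I, k) = D"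
    by auto
  ultimately show ?thesis
    by blast
qed

theorem proposition4p13:
  fixes p n :: nat
  assumes "1 \<le> p" and "p < n"
  shows "poset_isomorphism
    (I_ss p n) (relation_of (le_ss p) (I_ss p n))
    (J_Q p n) (relation_of (\<subseteq>) (J_Q p n))
    (phi_ss p n)"
proof -
  note iff = le_ss_iff_phi_ss_subset[OF assms]
  note in_J = phi_ss_in_J_Q[OF assms]
  have "inj_on (phi_ss p n) (I_ss p n)"
  proof (rule inj_onI)
    fix x y
    assume "x \<in> I_ss p n" "y \<in> I_ss p n" "phi_ss p n x = phi_ss p n y"
    then show "x = y"
      using iff[of x y] iff[of y x] by (intro le_ss_antisym) auto
  qed
  moreover have "phi_ss p n ` I_ss p n = J_Q p n"
    using in_J phi_ss_surj[OF assms] by blast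
  moreover have "partial_order_on (J_Q p n) (relation_of (\<subseteq>) (J_Q p n))"
    by (rule partial_order_on_relation_ofI) auto
  ultimately show ?thesis
    using partial_order_on_I_ss[OF assms] iff in_J
    by (auto simp: poset_isomorphism_def bij_betw_def relation_of_def)
qed

end
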